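(* Fix a prime $\ell$. Let $D$ be the discriminant of an order $\mathcal{O}$ in an imaginary quadratic number field such that a $2$-and-$2$ form $(L,M)$ of index $\ell$ arises from a pair of ideal classes in $\mathcal{O}$ (that is, up to rotation and homothety, $L$ and $M$ are proper fractional ideals of $\mathcal{O}$). Then $$|D|\leqslant 4\ell^2 .$$
   Context: A lattice in $\mathbb{R}^2\cong\mathbb{C}$ is the $\mathbb{Z}$-span of an $\mathbb{R}$-basis; $\langle\,,\rangle$ is the standard dot product; a homothety is multiplication by a positive real scalar. Let $\ell$ be a prime, $L$ a lattice and $M\subset L$ a sublattice of index $\ell$. The pair $(L,M)$ is a tempered perfect lattice (or form) of index $\ell$ if, after rescaling $L$ and $M$ by a common positive scalar, there exist non-empty sets $S\subset L-M$ and $S'\subset M-\{0\}$ such that, with $A(v)=\langle v,v\rangle$: (i) $A(v)=1$ for all $v\in S$; (ii) $A(v)>1$ for all $v\in L-M$ with $v\notin S$; (iii) $A(v)$ has a common value $u\geqslant 1$ for all $v\in S'$; (iv) $A(v)>u$ for all $v\in M-\{0\}$ with $v\notin S'$; (v) if $B$ is any positive definite quadratic form on $\mathbb{R}^2$ satisfying (i)--(iv) in place of $A$ with the same $S,S'$ and with common value $u'$ on $S'$, then $B=A$ and $u'=u$. It is called an $s$-and-$s'$ form if $S$ consists of $s$ pairs $\pm v$ and $S'$ consists of $s'$ pairs $\pm v$. For an imaginary quadratic field $K\subset\mathbb{C}$, a fractional ideal in $K$ is a finitely generated $\mathbb{Z}$-submodule of $K$ spanning $K$ over $\mathbb{Q}$;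 its coefficient ring is $\{\alpha\in K\mid \alpha L\subseteq L\}$. It is a proper fractional ideal of the order $\mathcal{O}$ if its coefficient ring equals $\mathcal{O}$. *)

theory Defs
  imports "HOL-Analysis.Analysis" "HOL-Computational_Algebra.Primes"
begin

global_interpretation int_module: module "\<lambda>(n::int) (z::complex). of_int n * z"
  by unfold_locales (simp_all add: algebra_simps)

global_interpretation rat_space: vector_space "\<lambda>(q::rat) (z::complex). of_rat q * z"
  by unfold_locales (simp_all add: algebra_simps of_rat_add of_rat_mult)

definition lattice :: "complex set \<Rightarrow> bool" where
  "lattice L \<longleftrightarrow> (\<exists>B. independent B \<and> span B = UNIV \<and> L = int_module.span B)"

definition cosets :: "complex set \<Rightarrow> complex set \<Rightarrow> complex set set" where
  "cosets L M = (\<lambda>x. (+) x ` M) ` L"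

definition sublattice_of_index :: "nat \<Rightarrow> complex set \<Rightarrow> complex set \<Rightarrow> bool" where
  "sublattice_of_index l L M \<longleftrightarrow>
     lattice L \<and> lattice M \<and> M \<subseteq> L \<and> finite (cosets L M) \<and> card (cosets L M) = l"

definition pos_def_quadratic_form :: "(complex \<Rightarrow> real) \<Rightarrow> bool" where
  "pos_def_quadratic_form A \<longleftrightarrow>
     (\<exists>b. bilinear b \<and> (\<forall>x y. b x y = b y x) \<and> (\<forall>x. A x = b x x)) \<and> (\<forall>x. x \<noteq> 0 \<longrightarrow> A x > 0)"

definition tempered_minima ::
  "complex set \<Rightarrow> complex set \<Rightarrow> complex set \<Rightarrow> complex set \<Rightarrow> (complex \<Rightarrow> real) \<Rightarrow> real \<Rightarrow> bool" where
  "tempered_minima L M S S' A u \<longleftrightarrow>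
     (\<forall>v\<in>S. A v = 1) \<and>
     (\<forall>v\<in>L - M. v \<notin> S \<longrightarrow> A v > 1) \<and>
     u \<ge> 1 \<and> (\<forall>v\<in>S'. A v = u) \<and>
     (\<forall>v\<in>M - {0}. v \<notin> S' \<longrightarrow> A v > u)"

definition normalized_tempered_perfect ::
  "complex set \<Rightarrow> complex set \<Rightarrow> complex set \<Rightarrow> complex set \<Rightarrow> bool" where
  "normalized_tempered_perfect L M S S' \<longleftrightarrow>
     S \<noteq> {} \<and> S \<subseteq> L - M \<and> S' \<noteq> {} \<and> S' \<subseteq> M - {0} \<and>
     (\<exists>u. tempered_minima L M S S' (\<lambda>v. v \<bullet> v) u \<and>
        (\<forall>B u'. pos_def_quadratic_form B \<and> tempered_minima L M S S' B u' \<longrightarrow>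
           B = (\<lambda>v. v \<bullet> v) \<and> u' = u))"

definition consists_of_pairs :: "nat \<Rightarrow> complex set \<Rightarrow> bool" where
  "consists_of_pairs s S \<longleftrightarrow>
     (\<exists>P. finite P \<and> card P = s \<and> (\<forall>p\<in>P. \<exists>v. v \<noteq> 0 \<and> p = {v, - v}) \<and> \<Union>P = S)"

definition s_and_s'_form :: "nat \<Rightarrow> nat \<Rightarrow> nat \<Rightarrow> complex set \<Rightarrow> complex set \<Rightarrow> bool" where
  "s_and_s'_form l s s' L M \<longleftrightarrow>
     sublattice_of_index l L M \<and>
     (\<exists>c>0. \<exists>S S'. normalized_tempered_perfect ((*\<^sub>R) c ` L) ((*\<^sub>R) c ` M) S S' \<and>
        consists_of_pairs s S \<and> consists_of_pairs s' S')"

text \<open>Since \<open>rat_space.dim\<close> is \<open>0\<close> for infinite-dimensional spaces, the value \<open>2\<close> means degree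
  two over the rationals.\<close>

definition imaginary_quadratic_field :: "complex set \<Rightarrow> bool" where
  "imaginary_quadratic_field K \<longleftrightarrow>
     0 \<in> K \<and> 1 \<in> K \<and>
     (\<forall>x\<in>K. \<forall>y\<in>K. x + y \<in> K \<and> x * y \<in> K) \<and>
     (\<forall>x\<in>K. - x \<in> K \<and> inverse x \<in> K) \<and>
     rat_space.dim K = 2 \<and> \<not> K \<subseteq> \<real>"

definition fractional_ideal :: "complex set \<Rightarrow> complex set \<Rightarrow> bool" where
  "fractional_ideal K I \<longleftrightarrow>
     (\<exists>G. finite G \<and> I = int_module.span G) \<and> I \<subseteq> K \<and> rat_space.span I = K"

definition coefficient_ring :: "complex set \<Rightarrow> complex set \<Rightarrow> complex set" where
  "coefficient_ring K I = {\<alpha> \<in> K. (*) \<alpha> ` I \<subseteq> I}"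

definition order_in :: "complex set \<Rightarrow> complex set \<Rightarrow> bool" where
  "order_in K R \<longleftrightarrow> fractional_ideal K R \<and> 1 \<in> R \<and> (\<forall>x\<in>R. \<forall>y\<in>R. x * y \<in> R)"

definition proper_fractional_ideal :: "complex set \<Rightarrow> complex set \<Rightarrow> complex set \<Rightarrow> bool" where
  "proper_fractional_ideal K R I \<longleftrightarrow> fractional_ideal K I \<and> coefficient_ring K I = R"

text \<open>The discriminant is the squared determinant of the matrix of conjugates of a
  \<open>\<int>\<close>-basis. The nontrivial automorphism of an imaginary quadratic field is complex
  conjugation, and the value does not depend on the basis, so that \<open>D\<close> is unique.\<close>

definition has_discriminant :: "complex set \<Rightarrow> int \<Rightarrow> bool" where
  "has_discriminant R D \<longleftrightarrow>
     (\<exists>\<alpha> \<beta>. \<alpha> \<noteq> \<beta> \<and> int_module.independent {\<alpha>, \<beta>} \<and> R = int_module.span {\<alpha>, \<beta>} \<and>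
        of_int D = (\<alpha> * cnj \<beta> - \<beta> * cnj \<alpha>)\<^sup>2)"

text \<open>A rotation followed by a homothety is multiplication by a nonzero complex number.
  It is applied to both lattices simultaneously.\<close>

definition arises_from_ideal_classes ::
  "complex set \<Rightarrow> complex set \<Rightarrow> complex set \<Rightarrow> complex set \<Rightarrow> bool" where
  "arises_from_ideal_classes K R L M \<longleftrightarrow>
     (\<exists>w. w \<noteq> 0 \<and> proper_fractional_ideal K R ((*) w ` L) \<and>
        proper_fractional_ideal K R ((*) w ` M))"

end

theory Submission
  imports Defs
begin

text \<open>
  Normalise so that the vectors in \<open>S\<close> have length \<open>1\<close>. Then \<open>S = {\<plusminus>a, \<plusminus>b}\<close> consists of
  shortest vectors of \<open>L\<close>, so \<open>a, b\<close> is a basis of \<open>L\<close>, and likewise \<open>S' = {\<plusminus>c, \<plusminus>d}\<close> yields a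
  basis of \<open>M\<close>. The reflection \<open>z \<mapsto> a b z\<^sup>*\<close> swaps \<open>a\<close> and \<open>b\<close> and preserves \<open>L\<close>; the
  reflection \<open>z \<mapsto> (c d / u) z\<^sup>*\<close> preserves \<open>M\<close>. Since \<open>l L \<subseteq> M\<close>, the composite, scaled by \<open>l\<close>,
  is multiplication by some \<open>\<gamma>\<close> with \<open>\<gamma> L \<subseteq> L\<close> and \<open>|\<gamma>| = l\<close>, so \<open>\<gamma>\<close> lies in the order. If \<open>\<gamma>\<close> is not real, then
  \<open>\<int> + \<int> \<gamma>\<close> has finite index in the order, so \<open>|D| \<le> 4 (Im \<gamma>)\<^sup>2 \<le> 4 l\<^sup>2\<close>. If \<open>\<gamma>\<close> is real, then
  both reflections have the same axes, and rescaling along these axes deforms the form while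
  preserving the minimal vectors, contradicting perfection.
\<close>

section \<open>Integer spans and the index of a sublattice\<close>

lemma int_span_pair:
  "x \<in> int_module.span {a, b} \<longleftrightarrow> (\<exists>m n::int. x = of_int m * a + of_int n * b)"
proof
  assume "x \<in> int_module.span {a, b}"
  then show "\<exists>m n::int. x = of_int m * a + of_int n * b"
  proof (induction rule: int_module.span_induct_alt)
    case base
    then show ?case by (metis add_0 mult_zero_left of_int_0)
  next
    case (step k x y)
    then obtain m n where y: "y = of_int m * a + of_int n * b" by blast
    from step(1) consider (1) "x = a" | (2) "x = b" by blast
    then show ?case
    proof cases
      case 1
      then have "of_int k * x + y = of_int (k + m) * a + of_int n * b"
        using y by (simp add: algebra_simps)
      then show ?thesis by blast
    next
      case 2
      then have "of_int k * x + y = of_int m * a + of_int (k + n) * b"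
        using y by (simp add: algebra_simps)
      then show ?thesis by blast
    qed
  qed
next
  assume "\<exists>m n::int. x = of_int m * a + of_int n * b"
  then show "x \<in> int_module.span {a, b}"
    using int_module.span_base[of _ "{a, b}"] by (auto intro: int_module.span_add int_module.span_scale)
qed

lemma lattice_subspace: "lattice L \<Longrightarrow> int_module.subspace L"
  by (auto simp: lattice_def)

lemma subspace_scaleR_image:
  assumes "int_module.subspace L"
  shows "int_module.subspace ((*\<^sub>R) k ` L)"
  unfolding int_module.subspace_def
proof (intro conjI ballI allI)
  show "0 \<in> (*\<^sub>R) k ` L"
    using int_module.subspace_0[OF assms] by (force intro: image_eqI[of _ _ 0])
  fix x assume x: "x \<in> (*\<^sub>R) k ` L"
  show "x + y \<in> (*\<^sub>R) k ` L" if "y \<in> (*\<^sub>R) k ` L" for y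
    using x that int_module.subspace_add[OF assms]
    by (auto simp flip: scaleR_add_right)
  show "of_int m * x \<in> (*\<^sub>R) k ` L" for m
  proof -
    obtain y where "y \<in> L" "x = k *\<^sub>R y" using x by blast
    then have "of_int m * x = k *\<^sub>R (of_int m * y)" "of_int m * y \<in> L"
      using int_module.subspace_scale[OF assms] by auto
    then show ?thesis by blast
  qed
qed

text \<open>Translation by \<open>x\<close> permutes the cosets of \<open>M\<close>; summing representatives over all cosets
  before and after this permutation shows that the index annihilates \<open>x\<close> modulo \<open>M\<close>.\<close>

lemma index_mult_mem:
  assumes L: "int_module.subspace L" and M: "int_module.subspace M" and "M \<subseteq> L"
    and fin: "finite (cosets L M)" and x: "x \<in> L"
  shows "of_nat (card (cosets L M)) * x \<in> M"
proof -
  define C where "C = cosets L M"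
  define r where "r c = (SOME y. y \<in> c)" for c :: "complex set"
  have M0: "0 \<in> M" by (rule int_module.subspace_0[OF M])
  have r: "r c \<in> c" if c: "c \<in> C" for c
  proof -
    obtain y where "c = (+) y ` M" using c unfolding C_def cosets_def by blast
    then have "y \<in> c" using M0 by (metis add.right_neutral image_eqI)
    then show ?thesis unfolding r_def by (rule someI)
  qed
  have closed: "(+) x ` c \<in> C" if c: "c \<in> C" for c
  proof -
    obtain y where y: "y \<in> L" "c = (+) y ` M" using c unfolding C_def cosets_def by blast
    then have "(+) x ` c = (+) (x + y) ` M" by (auto simp: image_image add.assoc)
    then show ?thesis using int_module.subspace_add[OF L x y(1)] by (auto simp: C_def cosets_def)
  qed
  have inj: "inj_on (\<lambda>c. (+) x ` c) C"
    by (rule inj_onI) (simp add: inj_image_eq_iff)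
  have img: "(\<lambda>c. (+) x ` c) ` C = C"
    using fin closed inj by (intro endo_inj_surj) (auto simp: C_def)
  have "(\<Sum>c\<in>C. r ((+) x ` c)) = (\<Sum>c\<in>C. r c)"
    using sum.reindex[OF inj, of r] img by (simp add: o_def)
  then have eq: "of_nat (card C) * x = (\<Sum>c\<in>C. x + r c - r ((+) x ` c))"
    by (simp add: sum_subtractf sum.distrib)
  have "x + r c - r ((+) x ` c) \<in> M" if c: "c \<in> C" for c
  proof -
    obtain y where y: "c = (+) y ` M" using c unfolding C_def cosets_def by blast
    obtain m where m: "m \<in> M" "r c = y + m" using r[OF c] y by auto
    obtain m' where m': "m' \<in> M" "r ((+) x ` c) = x + (y + m')"
      using r[OF closed[OF c]] y by auto
    show ?thesis using m m' int_module.subspace_diff[OF M m(1) m'(1)] by simp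
  qed
  then have "(\<Sum>c\<in>C. x + r c - r ((+) x ` c)) \<in> M"
    by (rule int_module.subspace_sum[OF M])
  then show ?thesis using eq by (simp add: C_def)
qed

section \<open>Shortest vectors as lattice bases\<close>

lemma pairs_two:
  assumes "consists_of_pairs 2 S"
  obtains a b where "S = {a, -a, b, -b}" "b \<noteq> a" "b \<noteq> -a"
proof -
  obtain P where P: "card P = 2" "\<And>p. p \<in> P \<Longrightarrow> \<exists>v. p = {v, - v}" "\<Union>P = S"
    using assms unfolding consists_of_pairs_def by metis
  obtain p q where pq: "P = {p, q}" "p \<noteq> q" using P(1) by (auto simp: card_2_iff)
  obtain a b where ab: "p = {a, -a}" "q = {b, -b}" using P(2)[of p] P(2)[of q] pq(1) by auto
  show thesis
  proof
    have "S = p \<union> q" using P(3) pq(1) by simp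
    then show "S = {a, -a, b, -b}" unfolding ab by blast
    have *: "{a, -a} \<noteq> {b, -b}" using pq(2) unfolding ab .
    then show "b \<noteq> a" by blast
    show "b \<noteq> -a"
    proof
      assume "b = -a"
      then have "{a, -a} = {b, -b}" by (simp add: insert_commute)
      with * show False by blast
    qed
  qed
qed

text \<open>Strict Cauchy-Schwarz for non-parallel vectors of equal length: expand the positive
  squared lengths of \<open>a + b\<close> and \<open>a - b\<close>.\<close>

lemma Re_mult_cnj_less:
  assumes "norm a = norm b" "b \<noteq> a" "b \<noteq> -a"
  shows "\<bar>Re (a * cnj b)\<bar> < (norm a)\<^sup>2"
proof -
  have "a + b \<noteq> 0" "a - b \<noteq> 0" using assms(2,3) by (simp_all add: add_eq_0_iff)
  then have "0 < (norm (a + b))\<^sup>2" "0 < (norm (a - b))\<^sup>2" by simp_all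
  moreover have "(norm b)\<^sup>2 = (norm a)\<^sup>2" using assms(1) by simp
  moreover have "(norm (a + b))\<^sup>2 = (norm a)\<^sup>2 + (norm b)\<^sup>2 + 2 * Re (a * cnj b)"
    "(norm (a - b))\<^sup>2 = (norm a)\<^sup>2 + (norm b)\<^sup>2 - 2 * Re (a * cnj b)"
    unfolding cmod_power2 by (simp_all add: power2_eq_square algebra_simps)
  ultimately show ?thesis by linarith
qed

text \<open>Up to sign, \<open>Im (a * cnj b)\<close> is the determinant of \<open>a, b\<close>, so
  this is linear independence over the reals.\<close>

lemma Im_mult_cnj_nonzero:
  assumes "norm a = norm b" "b \<noteq> a" "b \<noteq> -a"
  shows "Im (a * cnj b) \<noteq> 0"
proof
  assume "Im (a * cnj b) = 0"
  then have "(norm (a * cnj b))\<^sup>2 = (Re (a * cnj b))\<^sup>2" by (simp add: cmod_power2)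
  then have "((norm a)\<^sup>2)\<^sup>2 = (Re (a * cnj b))\<^sup>2"
    using assms(1) by (simp add: norm_mult power2_eq_square)
  moreover have "(Re (a * cnj b))\<^sup>2 < ((norm a)\<^sup>2)\<^sup>2"
    using Re_mult_cnj_less[OF assms]
    by (metis abs_ge_zero power2_abs power_strict_mono zero_less_numeral)
  ultimately show False by simp
qed

text \<open>Cramer's rule for the real basis \<open>a, b\<close>.\<close>

lemma real_combination:
  assumes "Im (a * cnj b) \<noteq> 0"
  shows "z = of_real (Im (z * cnj b) / Im (a * cnj b)) * a
           + of_real (Im (a * cnj z) / Im (a * cnj b)) * b"
proof -
  have "z * of_real (Im (a * cnj b)) = of_real (Im (z * cnj b)) * a + of_real (Im (a * cnj z)) * b"
    by (simp add: complex_eq_iff algebra_simps)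
  moreover have "complex_of_real (Im (a * cnj b)) \<noteq> 0"
    using assms by (simp only: of_real_eq_0_iff not_False_eq_True)
  ultimately have "z = (of_real (Im (z * cnj b)) * a + of_real (Im (a * cnj z)) * b)
      / of_real (Im (a * cnj b))"
    by (rule eq_divide_imp[rotated])
  then show ?thesis by (simp only: of_real_divide add_divide_distrib times_divide_eq_left)
qed

text \<open>Rounding the real coordinates of a lattice vector leaves a remainder in the lattice that
  is shorter than the minimum, hence zero.\<close>

lemma shortest_vectors_basis:
  assumes L: "int_module.subspace L" and min: "\<And>v. v \<in> L \<Longrightarrow> v \<noteq> 0 \<Longrightarrow> (norm v)\<^sup>2 \<ge> m"
    and ab: "a \<in> L" "b \<in> L" "(norm a)\<^sup>2 = m" "(norm b)\<^sup>2 = m" "b \<noteq> a" "b \<noteq> -a"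
  shows "L = int_module.span {a, b}"
proof
  show "int_module.span {a, b} \<subseteq> L"
    by (rule int_module.span_minimal) (use ab L in auto)
  have nn: "norm a = norm b" using ab by (metis norm_ge_zero power2_eq_imp_eq)
  define s where "s = Re (a * cnj b)"
  have s: "\<bar>s\<bar> < m" using Re_mult_cnj_less[OF nn ab(5,6)] ab(3) by (simp add: s_def)
  show "L \<subseteq> int_module.span {a, b}"
  proof
    fix v assume v: "v \<in> L"
    obtain x y where xy: "v = of_real x * a + of_real y * b"
      using real_combination[OF Im_mult_cnj_nonzero[OF nn ab(5,6)]] by blast
    define p q where "p = x - of_int (round x)" and "q = y - of_int (round y)"
    define w where "w = v - (of_int (round x) * a + of_int (round y) * b)"
    have w: "w = of_real p * a + of_real q * b"
      by (simp add: w_def p_def q_def xy algebra_simps)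
    have wL: "w \<in> L" unfolding w_def
      by (intro int_module.subspace_diff[OF L] int_module.subspace_add[OF L]
          int_module.subspace_scale[OF L] v ab)
    have pq: "\<bar>p\<bar> \<le> 1/2" "\<bar>q\<bar> \<le> 1/2"
      using of_int_round_abs_le[of x] of_int_round_abs_le[of y] by (auto simp: p_def q_def abs_minus_commute)
    have "(norm w)\<^sup>2 = p\<^sup>2 * (norm a)\<^sup>2 + q\<^sup>2 * (norm b)\<^sup>2 + 2 * (p * q) * s"
      unfolding w s_def cmod_power2 by (simp add: power2_eq_square algebra_simps)
    also have "\<dots> = p\<^sup>2 * m + q\<^sup>2 * m + 2 * (p * q) * s" using ab by simp
    \<comment> \<open>The three terms are at most \<open>m/4\<close>, \<open>m/4\<close> and
      \<open>\<bar>s\<bar>/2\<close>, and \<open>\<bar>s\<bar> < m\<close> makes the inequality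
      strict.\<close>
    also have "\<dots> < m"
    proof -
      have p2: "p\<^sup>2 \<le> 1/4" "q\<^sup>2 \<le> 1/4"
        using power_mono[OF pq(1), of 2] power_mono[OF pq(2), of 2] by (auto simp: power_divide)
      have "\<bar>p * q\<bar> \<le> 1/2 * (1/2)" unfolding abs_mult by (intro mult_mono pq) auto
      then have "\<bar>(p * q) * s\<bar> \<le> 1/4 * \<bar>s\<bar>" unfolding abs_mult[of "p * q"] by (intro mult_right_mono) auto
      moreover have "p\<^sup>2 * m \<le> 1/4 * m" "q\<^sup>2 * m \<le> 1/4 * m"
        using p2 s by (intro mult_right_mono; linarith)+
      ultimately show ?thesis using s by linarith
    qed
    finally have "w = 0" using min[OF wL] by linarith
    then show "v \<in> int_module.span {a, b}" unfolding int_span_pair w_def by auto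
  qed
qed

section \<open>Discreteness of the lengths in a lattice\<close>

text \<open>By Cramer's rule a bound on the length bounds both integer coordinates; \<open>k\<close>
  is a common bound for the two.\<close>

lemma finite_lattice_ball:
  assumes "Im (a * cnj b) \<noteq> 0"
  shows "finite {v \<in> int_module.span {a, b}. norm v \<le> r}"
proof -
  define k where "k = (norm a + norm b) * r / \<bar>Im (a * cnj b)\<bar>"
  define F where "F = {-\<lceil>k\<rceil>..\<lceil>k\<rceil>}"
  have "{v \<in> int_module.span {a, b}. norm v \<le> r}
      \<subseteq> (\<lambda>(m, n). of_int m * a + of_int n * b) ` (F \<times> F)"
  proof clarify
    fix v assume v: "v \<in> int_module.span {a, b}" "norm v \<le> r"
    obtain m n :: int where mn: "v = of_int m * a + of_int n * b"
      using v(1) unfolding int_span_pair by blast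
    have "Im (v * cnj b) = m * Im (a * cnj b)" "Im (a * cnj v) = n * Im (a * cnj b)"
      unfolding mn by (simp_all add: algebra_simps)
    moreover have "\<bar>Im (v * cnj b)\<bar> \<le> (norm a + norm b) * r" "\<bar>Im (a * cnj v)\<bar> \<le> (norm a + norm b) * r"
    proof -
      have r: "0 \<le> r" using v(2) norm_ge_zero[of v] by linarith
      have "\<bar>Im (v * cnj b)\<bar> \<le> norm v * norm b" "\<bar>Im (a * cnj v)\<bar> \<le> norm a * norm v"
        using abs_Im_le_cmod[of "v * cnj b"] abs_Im_le_cmod[of "a * cnj v"] by (simp_all add: norm_mult)
      moreover have "norm v * norm b \<le> r * norm b" "norm a * norm v \<le> norm a * r"
        using v(2) by (auto intro: mult_right_mono mult_left_mono)
      moreover have "0 \<le> norm a * r" "0 \<le> norm b * r" using r by auto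
      ultimately show "\<bar>Im (v * cnj b)\<bar> \<le> (norm a + norm b) * r"
        "\<bar>Im (a * cnj v)\<bar> \<le> (norm a + norm b) * r" unfolding distrib_right mult.commute[of r] by linarith+
    qed
    ultimately have "\<bar>real_of_int m\<bar> \<le> k" "\<bar>real_of_int n\<bar> \<le> k"
      unfolding k_def using assms by (simp_all only: abs_mult pos_le_divide_eq zero_less_abs_iff not_False_eq_True)
    then have "m \<in> F" "n \<in> F" unfolding F_def by (auto simp: abs_le_iff) linarith+
    then show "v \<in> (\<lambda>(m, n). of_int m * a + of_int n * b) ` (F \<times> F)" using mn by auto
  qed
  then show ?thesis by (rule finite_subset) (simp add: F_def)
qed

text \<open>Only finitely many squared lengths lie in a bounded range, so the next one above
  \<open>t\<close> is at a positive distance. This leaves room for a small perturbation of the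
  form.\<close>

lemma lattice_norm_gap:
  assumes "Im (a * cnj b) \<noteq> 0"
  obtains \<delta> where "\<delta> > 0"
    "\<And>v. v \<in> int_module.span {a, b} \<Longrightarrow> t < (norm v)\<^sup>2 \<Longrightarrow> t + \<delta> \<le> (norm v)\<^sup>2"
proof -
  define N where "N = (\<lambda>v. (norm v)\<^sup>2) ` {v \<in> int_module.span {a, b}. norm v \<le> \<bar>t\<bar> + 1}"
  \<comment> \<open>The extra element \<open>t + 1\<close> makes \<open>E\<close> non-empty and
    serves the vectors outside the ball, whose squared length is at least
    \<open>\<bar>t\<bar> + 1\<close>.\<close>
  define E where "E = insert (t + 1) {x \<in> N. t < x}"
  have fin: "finite E" using finite_lattice_ball[OF assms] by (simp add: E_def N_def)
  show thesis
  proof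
    show "Min E - t > 0" using fin by (simp add: E_def)
    fix v assume v: "v \<in> int_module.span {a, b}" "t < (norm v)\<^sup>2"
    have "Min E \<le> (norm v)\<^sup>2"
    proof (cases "norm v \<le> \<bar>t\<bar> + 1")
      case True
      then have "(norm v)\<^sup>2 \<in> E" using v by (auto simp: E_def N_def)
      then show ?thesis using fin by simp
    next
      case False
      then have "\<bar>t\<bar> + 1 \<le> (norm v)\<^sup>2"
        using power_mono[of "\<bar>t\<bar> + 1" "norm v" 2] self_le_power[of "\<bar>t\<bar> + 1" 2] by linarith
      moreover have "Min E \<le> t + 1" using fin by (simp add: E_def)
      ultimately show ?thesis by simp
    qed
    then show "t + (Min E - t) \<le> (norm v)\<^sup>2" by simp
  qed
qed

section \<open>Deformation of the form along fixed axes\<close>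

text \<open>For a unit \<open>e\<close>, in orthonormal coordinates x, y with the x-axis along a
  square root of \<open>e\<close>, the first term is x*x - y*y. Hence the form is invariant under
  the reflection \<open>e * cnj z\<close>. The parameter \<open>\<tau>\<close> is there to make it
  vanish at chosen vectors.\<close>

definition axis_form :: "complex \<Rightarrow> real \<Rightarrow> complex \<Rightarrow> real" where
  "axis_form e \<tau> z = Re (z\<^sup>2 * cnj e) - \<tau> * (norm z)\<^sup>2"

lemma abs_axis_form_le:
  assumes "norm e = 1" "\<bar>\<tau>\<bar> \<le> 1"
  shows "\<bar>axis_form e \<tau> z\<bar> \<le> 2 * (norm z)\<^sup>2"
proof -
  have "\<bar>Re (z\<^sup>2 * cnj e)\<bar> \<le> (norm z)\<^sup>2"
    using abs_Re_le_cmod[of "z\<^sup>2 * cnj e"] assms(1) by (simp add: norm_mult norm_power)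
  moreover have "\<bar>\<tau> * (norm z)\<^sup>2\<bar> \<le> 1 * (norm z)\<^sup>2"
    unfolding abs_mult using assms(2) by (intro mult_mono) auto
  ultimately show ?thesis unfolding axis_form_def by linarith
qed

text \<open>The axis form is at most twice the squared length, so a factor below \<open>1/2\<close>
  cannot destroy positivity. The bilinear form is the polarisation, with \<open>x * y\<close> in
  place of the square.\<close>

lemma pos_def_axis_perturbation:
  assumes "norm e = 1" "\<bar>\<tau>\<bar> \<le> 1" "\<bar>\<epsilon>\<bar> < 1/2"
  shows "pos_def_quadratic_form (\<lambda>z. z \<bullet> z + \<epsilon> * axis_form e \<tau> z)"
  unfolding pos_def_quadratic_form_def
proof (intro conjI exI[of _ "\<lambda>x y. x \<bullet> y + \<epsilon> * (Re (x * y * cnj e) - \<tau> * (x \<bullet> y))"] allI impI)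
  show "bilinear (\<lambda>x y. x \<bullet> y + \<epsilon> * (Re (x * y * cnj e) - \<tau> * (x \<bullet> y)))"
    unfolding bilinear_def by (auto intro!: linearI simp: inner_complex_def algebra_simps)
  fix x y :: complex
  show "x \<bullet> y + \<epsilon> * (Re (x * y * cnj e) - \<tau> * (x \<bullet> y)) =
        y \<bullet> x + \<epsilon> * (Re (y * x * cnj e) - \<tau> * (y \<bullet> x))"
    by (simp add: inner_commute mult.commute[of x y])
  show "x \<bullet> x + \<epsilon> * axis_form e \<tau> x = x \<bullet> x + \<epsilon> * (Re (x * x * cnj e) - \<tau> * (x \<bullet> x))"
    by (simp add: axis_form_def power2_norm_eq_inner power2_eq_square[of x])
  assume "x \<noteq> 0"
  then have pos: "0 < (norm x)\<^sup>2" by simp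
  have "\<bar>\<epsilon> * axis_form e \<tau> x\<bar> \<le> \<bar>\<epsilon>\<bar> * (2 * (norm x)\<^sup>2)"
    unfolding abs_mult[of \<epsilon>] using abs_axis_form_le[OF assms(1,2)] by (intro mult_left_mono) auto
  moreover have "\<bar>\<epsilon>\<bar> * (2 * (norm x)\<^sup>2) < 1/2 * (2 * (norm x)\<^sup>2)"
    using assms(3) pos by (intro mult_strict_right_mono) auto
  ultimately show "0 < x \<bullet> x + \<epsilon> * axis_form e \<tau> x"
    unfolding power2_norm_eq_inner by linarith
qed

lemma tempered_minima_norm:
  assumes "tempered_minima L M S S' (\<lambda>v. v \<bullet> v) u"
  shows "u \<ge> 1" "v \<in> S \<Longrightarrow> (norm v)\<^sup>2 = 1" "v \<in> S' \<Longrightarrow> (norm v)\<^sup>2 = u"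
    "v \<in> L \<Longrightarrow> v \<notin> M \<Longrightarrow> v \<notin> S \<Longrightarrow> 1 < (norm v)\<^sup>2"
    "v \<in> M \<Longrightarrow> v \<noteq> 0 \<Longrightarrow> v \<notin> S' \<Longrightarrow> u < (norm v)\<^sup>2"
  using assms by (simp_all add: tempered_minima_def power2_norm_eq_inner)

text \<open>The relation between \<open>c * d\<close> and \<open>a * b\<close> says that the
  reflections swapping \<open>a, b\<close> and \<open>c, d\<close> have the same axes. A multiple of
  the axis form \<open>Q\<close> can then be added: it vanishes on \<open>S\<close> and is constant
  on \<open>S'\<close>, and the length gaps preserve the strict inequalities elsewhere.\<close>

lemma common_axes_not_perfect:
  assumes sub: "M \<subseteq> L" and Lspan: "L = int_module.span {a, b}"
    and S: "S = {a, -a, b, -b}" "b \<noteq> a" "b \<noteq> -a"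
    and S': "S' = {c, -c, d, -d}" "c * d = of_real \<sigma> * (a * b)" "\<sigma> \<noteq> 0"
    and min: "tempered_minima L M S S' (\<lambda>v. v \<bullet> v) u"
  obtains B u' where "pos_def_quadratic_form B" "tempered_minima L M S S' B u'"
    "B \<noteq> (\<lambda>v. v \<bullet> v)"
proof -
  note m = tempered_minima_norm[OF min]
  have u: "u \<ge> 1" by (rule m)
  have na: "(norm a)\<^sup>2 = 1" "(norm b)\<^sup>2 = 1" using S by (simp_all add: m(2))
  have nc: "(norm c)\<^sup>2 = u" "(norm d)\<^sup>2 = u" using S' by (simp_all add: m(3))
  have n1: "norm a = 1" "norm b = 1" using na by (simp_all add: power2_eq_iff_nonneg[of _ 1, simplified])
  \<comment> \<open>This is the value of \<open>Re (z\<^sup>2 * cnj (a * b))\<close> at both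
    \<open>a\<close> and \<open>b\<close>.\<close>
  define \<tau> where "\<tau> = Re (a * cnj b)"
  have \<tau>: "\<bar>\<tau>\<bar> < 1" using Re_mult_cnj_less[OF _ S(2,3)] n1 by (simp add: \<tau>_def)
  define Q where "Q = axis_form (a * b) \<tau>"
  have e1: "norm (a * b) = 1" by (simp add: norm_mult n1)
  have Qle: "\<bar>Q z\<bar> \<le> 2 * (norm z)\<^sup>2" for z
    unfolding Q_def using abs_axis_form_le[OF e1] \<tau> by simp
  have aa: "a * cnj a = 1" "b * cnj b = 1" by (simp_all add: complex_norm_square[symmetric] n1)
  have Qminus: "Q (- z) = Q z" for z by (simp add: Q_def axis_form_def)
  have Qa: "Q a = 0"
  proof -
    have "a\<^sup>2 * cnj (a * b) = a * cnj b"
      using aa(1) by (simp add: power2_eq_square)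
    then show ?thesis by (simp only: Q_def axis_form_def \<tau>_def n1 power_one mult_1_right diff_self)
  qed
  have Qb: "Q b = 0"
  proof -
    have "b\<^sup>2 * cnj (a * b) = cnj (a * cnj b) * (b * cnj b)" by (simp add: power2_eq_square)
    then show ?thesis by (simp only: Q_def axis_form_def \<tau>_def n1 aa power_one mult_1_right diff_self cnj.simps)
  qed
  \<comment> \<open>With \<open>c * d\<close> in place of \<open>a * b\<close>, both values are
    \<open>u * Re (c * cnj d)\<close>; the common real factor \<open>\<sigma>\<close> is then
    cancelled.\<close>
  have Qcd: "Q c = Q d"
  proof -
    have *: "\<sigma> * Re (z\<^sup>2 * cnj (a * b)) = Re (z\<^sup>2 * cnj (c * d))" for z
      unfolding S'(2) by (simp add: algebra_simps)
    have cc: "c * cnj c = of_real u" "d * cnj d = of_real u"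
      by (simp_all add: complex_norm_square[symmetric] nc flip: of_real_power)
    have "c\<^sup>2 * cnj (c * d) = (c * cnj c) * (c * cnj d)"
      by (simp add: power2_eq_square)
    then have "c\<^sup>2 * cnj (c * d) = of_real u * (c * cnj d)" unfolding cc .
    moreover have "d\<^sup>2 * cnj (c * d) = (d * cnj d) * cnj (c * cnj d)"
      by (simp add: power2_eq_square)
    then have "d\<^sup>2 * cnj (c * d) = of_real u * cnj (c * cnj d)" unfolding cc .
    ultimately have "Re (c\<^sup>2 * cnj (c * d)) = Re (d\<^sup>2 * cnj (c * d))"
      by (simp only: Re_complex_of_real Im_complex_of_real times_complex.sel cnj.sel)
    then have "Re (c\<^sup>2 * cnj (a * b)) = Re (d\<^sup>2 * cnj (a * b))" using *[of c] *[of d] S'(3)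
      by (metis mult_left_cancel)
    then show ?thesis by (simp only: Q_def axis_form_def nc)
  qed
  \<comment> \<open>The vector \<open>a + b\<close> lies on an axis and witnesses that the
    deformation is not trivial.\<close>
  have Qab: "Q (a + b) \<noteq> 0"
  proof -
    have "(a + b)\<^sup>2 * cnj (a * b) = (a * cnj a) * (a * cnj b) + 2 * (a * cnj a) * (b * cnj b) + (b * cnj b) * cnj (a * cnj b)"
      by (simp add: power2_eq_square algebra_simps)
    then have "Re ((a + b)\<^sup>2 * cnj (a * b)) = 2 + 2 * \<tau>" unfolding aa \<tau>_def by simp
    moreover have "(norm (a + b))\<^sup>2 = (norm a)\<^sup>2 + (norm b)\<^sup>2 + 2 * \<tau>"
      unfolding cmod_power2 \<tau>_def by (simp add: power2_eq_square algebra_simps)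
    ultimately have "Q (a + b) = (2 + 2 * \<tau>) * (1 - \<tau>)"
      unfolding Q_def axis_form_def na by (simp add: algebra_simps)
    then show ?thesis using \<tau> by auto
  qed
  have im: "Im (a * cnj b) \<noteq> 0" using Im_mult_cnj_nonzero[OF _ S(2,3)] n1 by simp
  \<comment> \<open>Both gaps are taken in \<open>L\<close>, whose basis is given; the second one
    applies to \<open>M\<close> as a subset.\<close>
  obtain \<delta>1 where \<delta>1: "\<delta>1 > 0" "\<And>v. v \<in> L \<Longrightarrow> 1 < (norm v)\<^sup>2 \<Longrightarrow> 1 + \<delta>1 \<le> (norm v)\<^sup>2"
    using lattice_norm_gap[OF im] Lspan by metis
  obtain \<delta>2 where \<delta>2: "\<delta>2 > 0" "\<And>v. v \<in> L \<Longrightarrow> u < (norm v)\<^sup>2 \<Longrightarrow> u + \<delta>2 \<le> (norm v)\<^sup>2"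
    using lattice_norm_gap[OF im] Lspan by metis
  define \<delta> where "\<delta> = min \<delta>1 \<delta>2"
  have \<delta>: "\<delta> > 0" using \<delta>1 \<delta>2 by (simp add: \<delta>_def)
  \<comment> \<open>Chosen so that \<open>4 * k * t + 2 * k * \<delta> < \<delta>\<close> whenever
    \<open>t \<le> u\<close>, which is the inequality behind \<open>gap\<close>.\<close>
  define k where "k = \<delta> / (4 * u + 4 * \<delta>)"
  have den: "4 * u + 4 * \<delta> > 0" using u \<delta> by simp
  have kpos: "k > 0" using \<delta> den by (simp add: k_def)
  have kden: "k * (4 * u + 4 * \<delta>) = \<delta>" using den by (simp add: k_def)
  have khalf: "k < 1/2" using \<delta> u den by (simp add: k_def field_simps)
  \<comment> \<open>The sign is chosen so that \<open>u\<close> does not decrease, since \<open>u = 1\<close> is not excluded.\<close>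
  define \<epsilon> where "\<epsilon> = (if Q c \<ge> 0 then k else - k)"
  have abs\<epsilon>: "\<bar>\<epsilon>\<bar> = k" using kpos by (simp add: \<epsilon>_def)
  define B where "B = (\<lambda>v. v \<bullet> v + \<epsilon> * Q v)"
  have Bn: "B v = (norm v)\<^sup>2 + \<epsilon> * Q v" for v by (simp add: B_def power2_norm_eq_inner)
  have eQ: "\<bar>\<epsilon> * Q v\<bar> \<le> k * (2 * (norm v)\<^sup>2)" for v
    unfolding abs_mult abs\<epsilon> using Qle kpos by (intro mult_left_mono) auto
  have lower: "(1 - 2 * k) * (norm v)\<^sup>2 \<le> B v" for v
    using eQ[of v] unfolding Bn by (simp add: algebra_simps)
  \<comment> \<open>Applied with \<open>t = 1\<close> on \<open>L - M\<close> and with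
    \<open>t = u\<close> on \<open>M\<close>, where the margin \<open>2 * k * u\<close> absorbs the
    growth from \<open>u\<close> to \<open>u'\<close>.\<close>
  have gap: "t + 2 * k * t < B v" if "t \<le> u" "t + \<delta> \<le> (norm v)\<^sup>2" for v t
  proof -
    have "k * t \<le> k * u" using that kpos by simp
    moreover have "k * (4 * u) + k * (4 * \<delta>) = \<delta>" using kden by (simp add: algebra_simps)
    moreover have "0 < k * \<delta>" using kpos \<delta> by simp
    ultimately have "t + 2 * k * t < (1 - 2 * k) * (t + \<delta>)" by (simp add: algebra_simps)
    also have "\<dots> \<le> (1 - 2 * k) * (norm v)\<^sup>2" using that khalf by (intro mult_left_mono) auto
    finally show ?thesis using lower[of v] by linarith
  qed
  define u' where "u' = u + \<epsilon> * Q c"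
  have u'1: "u' \<ge> 1"
  proof -
    have "0 \<le> \<epsilon> * Q c" using kpos by (simp add: \<epsilon>_def zero_le_mult_iff)
    then show ?thesis using u by (simp add: u'_def)
  qed
  have u'le: "u' \<le> u + 2 * k * u" using eQ[of c] nc unfolding u'_def by simp
  show thesis
  proof
    show "pos_def_quadratic_form B"
      unfolding B_def Q_def using \<tau> abs\<epsilon> khalf by (intro pos_def_axis_perturbation e1) auto
    show "B \<noteq> (\<lambda>v. v \<bullet> v)"
    proof
      assume "B = (\<lambda>v. v \<bullet> v)"
      then have "B (a + b) = (a + b) \<bullet> (a + b)" by simp
      then show False using Qab kpos unfolding B_def \<epsilon>_def by (auto split: if_splits)
    qed
    show "tempered_minima L M S S' B u'"
      unfolding tempered_minima_def
    proof (intro conjI ballI impI)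
      show "B v = 1" if "v \<in> S" for v
        using that na unfolding Bn S by (auto simp: Qminus Qa Qb)
      show "1 < B v" if v: "v \<in> L - M" "v \<notin> S" for v
      proof -
        have "1 + \<delta> \<le> (norm v)\<^sup>2" using \<delta>1(2)[of v] m(4)[of v] v by (simp add: \<delta>_def)
        then show ?thesis using gap[of 1 v] u kpos by simp
      qed
      show "1 \<le> u'" by (rule u'1)
      show "B v = u'" if "v \<in> S'" for v
        using that nc Qcd unfolding Bn S' u'_def by (auto simp: Qminus)
      show "u' < B v" if v: "v \<in> M - {0}" "v \<notin> S'" for v
      proof -
        have "u + \<delta> \<le> (norm v)\<^sup>2" using \<delta>2(2)[of v] m(5)[of v] v subsetD[OF sub] by (simp add: \<delta>_def)
        then show ?thesis using gap[of u v] u'le by simp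
      qed
    qed
  qed
qed

section \<open>Discriminants and coefficient rings\<close>

text \<open>With \<open>i\<close> the determinant of the basis \<open>x, y\<close>, up to sign,
  \<open>D\<close> is \<open>- 4 * i\<^sup>2\<close>. The determinant of \<open>1, \<gamma>\<close>
  is a non-zero integer multiple of \<open>i\<close>, so
  \<open>\<bar>i\<bar> \<le> \<bar>Im \<gamma>\<bar>\<close>.\<close>

lemma discriminant_bound:
  assumes "has_discriminant R D" "1 \<in> R" "\<gamma> \<in> R" "Im \<gamma> \<noteq> 0"
  shows "\<bar>real_of_int D\<bar> \<le> 4 * (Im \<gamma>)\<^sup>2"
proof -
  obtain x y where R: "R = int_module.span {x, y}"
    and D: "of_int D = (x * cnj y - y * cnj x)\<^sup>2"
    using assms(1) unfolding has_discriminant_def by blast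
  define i where "i = Im (x * cnj y)"
  have "x * cnj y - y * cnj x = Complex 0 (2 * i)" by (simp add: complex_eq_iff i_def)
  then have "complex_of_int D = of_real (- 4 * i\<^sup>2)"
    unfolding D by (simp add: complex_eq_iff power2_eq_square)
  then have Di: "real_of_int D = - 4 * i\<^sup>2" by (metis of_real_eq_iff of_real_of_int_eq)
  obtain p q r s :: int where *: "1 = of_int p * x + of_int q * y" "\<gamma> = of_int r * x + of_int s * y"
    using assms(2,3) unfolding R int_span_pair by metis
  have "Im (1 * cnj \<gamma>) = of_int (p * s - q * r) * i"
    unfolding * i_def by (simp add: algebra_simps)
  then have g: "- Im \<gamma> = of_int (p * s - q * r) * i" by simp
  then have "p * s - q * r \<noteq> 0" using assms(4) by (metis mult_zero_left neg_equal_0_iff_equal of_int_0)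
  then have "1 \<le> \<bar>real_of_int (p * s - q * r)\<bar>" by linarith
  then have "1 * \<bar>i\<bar> \<le> \<bar>real_of_int (p * s - q * r)\<bar> * \<bar>i\<bar>" by (intro mult_right_mono) auto
  then have "\<bar>i\<bar> \<le> \<bar>Im \<gamma>\<bar>" using g by (metis abs_minus_cancel abs_mult mult_1)
  then have "i\<^sup>2 \<le> (Im \<gamma>)\<^sup>2" by (simp add: abs_le_square_iff)
  then show ?thesis unfolding Di by simp
qed

text \<open>Membership of \<open>\<gamma>\<close> in \<open>K\<close> comes from dividing
  \<open>\<gamma> * x\<close> by \<open>x\<close>, both in the ideal and thus in
  \<open>K\<close>.\<close>

lemma coefficient_ringI:
  assumes K: "imaginary_quadratic_field K" and I: "proper_fractional_ideal K R I"
    and x: "x \<in> I" "x \<noteq> 0" and mult: "\<And>v. v \<in> I \<Longrightarrow> \<gamma> * v \<in> I"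
  shows "\<gamma> \<in> R"
proof -
  have IK: "I \<subseteq> K" and R: "coefficient_ring K I = R"
    using I by (auto simp: proper_fractional_ideal_def fractional_ideal_def)
  have "(\<gamma> * x) * inverse x \<in> K"
    using K IK x mult[OF x(1)] unfolding imaginary_quadratic_field_def by blast
  then have "\<gamma> \<in> K" using x by (simp add: field_simps)
  then show ?thesis using mult R unfolding coefficient_ring_def by auto
qed

section \<open>The multiplier obtained from two reflections\<close>

text \<open>Since \<open>u \<ge> 1\<close>, non-zero vectors of \<open>M\<close> also have length at
  least \<open>1\<close>. Thus \<open>S\<close> consists of shortest vectors of all of
  \<open>L\<close>, not only of \<open>L - M\<close>.\<close>

lemma tempered_minima_bases:
  assumes L: "int_module.subspace L" and M: "int_module.subspace M"
    and min: "tempered_minima L M S S' (\<lambda>v. v \<bullet> v) u"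
    and S: "S = {a, -a, b, -b}" "b \<noteq> a" "b \<noteq> -a" "S \<subseteq> L - M"
    and S': "S' = {c, -c, d, -d}" "d \<noteq> c" "d \<noteq> -c" "S' \<subseteq> M - {0}"
  shows "L = int_module.span {a, b}" "M = int_module.span {c, d}"
proof -
  note m = tempered_minima_norm[OF min]
  have Mge: "u \<le> (norm v)\<^sup>2" if "v \<in> M" "v \<noteq> 0" for v
    using m(3,5)[of v] that by (cases "v \<in> S'") simp_all
  have Lge: "1 \<le> (norm v)\<^sup>2" if "v \<in> L" "v \<noteq> 0" for v
  proof (cases "v \<in> M")
    case True
    then show ?thesis using Mge[OF _ that(2)] m(1) by simp
  next
    case False
    then show ?thesis using m(2,4)[of v] that by (cases "v \<in> S") simp_all
  qed
  have "a \<in> S" "b \<in> S" "c \<in> S'" "d \<in> S'" using S(1) S'(1) by simp_all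
  then have mem: "a \<in> L" "b \<in> L" "c \<in> M" "d \<in> M"
    and norms: "(norm a)\<^sup>2 = 1" "(norm b)\<^sup>2 = 1" "(norm c)\<^sup>2 = u" "(norm d)\<^sup>2 = u"
    using S(4) S'(4) m(2,3) by blast+
  show "L = int_module.span {a, b}"
    by (rule shortest_vectors_basis[OF L Lge mem(1,2) norms(1,2) S(2,3)])
  show "M = int_module.span {c, d}"
    by (rule shortest_vectors_basis[OF M Mge mem(3,4) norms(3,4) S'(2,3)])
qed

text \<open>The multiplication is a composite of three maps: swap the coordinates along
  \<open>a, b\<close>, scale by \<open>l\<close> to enter \<open>M\<close>, then swap the
  coordinates along \<open>c, d\<close>.\<close>

lemma reflections_multiplier:
  assumes sub: "M \<subseteq> L" and lL: "\<And>v. v \<in> L \<Longrightarrow> of_nat l * v \<in> M"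
    and Lspan: "L = int_module.span {a, b}" and Mspan: "M = int_module.span {c, d}"
    and na: "(norm a)\<^sup>2 = 1" "(norm b)\<^sup>2 = 1"
    and nc: "(norm c)\<^sup>2 = u" "(norm d)\<^sup>2 = u" and u: "u \<noteq> 0"
    and v: "v \<in> L"
  shows "of_nat l * (c * d / of_real u) * cnj (a * b) * v \<in> L"
proof -
  have aa: "a * cnj a = 1" "b * cnj b = 1"
    by (simp_all add: complex_norm_square[symmetric] na flip: of_real_power)
  have cc: "c * cnj c = of_real u" "d * cnj d = of_real u"
    by (simp_all add: complex_norm_square[symmetric] nc flip: of_real_power)
  obtain x y :: int where xy: "v = of_int x * a + of_int y * b"
    using v unfolding Lspan int_span_pair by blast
  define v' where "v' = of_int x * b + of_int y * a"
  have "v' = of_int y * a + of_int x * b" by (simp add: v'_def)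
  then have "v' \<in> L" unfolding Lspan int_span_pair by blast
  then obtain p q :: int where pq: "of_nat l * v' = of_int p * c + of_int q * d"
    using lL[of v'] unfolding Mspan int_span_pair by blast
  have "cnj (a * b) * v = of_int x * (a * cnj a) * cnj b + of_int y * (b * cnj b) * cnj a"
    unfolding xy by (simp add: algebra_simps)
  \<comment> \<open>Equivalently \<open>v' = a * b * cnj v\<close>, as \<open>a\<close> and
    \<open>b\<close> are units: the swap is a reflection.\<close>
  then have eq: "cnj (a * b) * v = cnj v'" unfolding aa v'_def by simp
  have "c * d * cnj (of_nat l * v') = of_int p * (c * cnj c) * d + of_int q * (d * cnj d) * c"
    unfolding pq by (simp add: algebra_simps)
  \<comment> \<open>The coefficients \<open>p\<close> and \<open>q\<close> have changed places,
    which is the reflection of \<open>M\<close>.\<close>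
  also have "\<dots> = of_real u * (of_int q * c + of_int p * d)"
    unfolding cc by (simp add: algebra_simps)
  finally have "of_nat l * (c * d / of_real u) * cnj v' = of_int q * c + of_int p * d"
    using u by (simp add: field_simps)
  then have "of_nat l * (c * d / of_real u) * cnj v' \<in> M"
    unfolding Mspan int_span_pair by blast
  then show ?thesis using sub unfolding mult.assoc[of _ "cnj (a * b)" v] eq by blast
qed

text \<open>Perfection enters only to exclude a real multiplier, which would force the two
  reflections to share their axes.\<close>

lemma perfect_pair_multiplier:
  assumes L: "int_module.subspace L" and M: "int_module.subspace M" and "M \<subseteq> L"
    and l: "l \<noteq> 0" and lL: "\<And>v. v \<in> L \<Longrightarrow> of_nat l * v \<in> M"
    and perfect: "normalized_tempered_perfect L M S S'"
    and pairs: "consists_of_pairs 2 S" "consists_of_pairs 2 S'"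
  obtains \<gamma> where "norm \<gamma> = real l" "Im \<gamma> \<noteq> 0" "\<And>v. v \<in> L \<Longrightarrow> \<gamma> * v \<in> L"
proof -
  obtain u where min: "tempered_minima L M S S' (\<lambda>v. v \<bullet> v) u"
    and perf: "\<And>B u'. pos_def_quadratic_form B \<Longrightarrow> tempered_minima L M S S' B u' \<Longrightarrow>
           B = (\<lambda>v. v \<bullet> v)"
    and SL: "S \<subseteq> L - M" and SM: "S' \<subseteq> M - {0}"
    using perfect unfolding normalized_tempered_perfect_def by blast
  obtain a b where S: "S = {a, -a, b, -b}" "b \<noteq> a" "b \<noteq> -a" using pairs_two[OF pairs(1)] .
  obtain c d where S': "S' = {c, -c, d, -d}" "d \<noteq> c" "d \<noteq> -c" using pairs_two[OF pairs(2)] .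
  note m = tempered_minima_norm[OF min]
  have u: "u \<ge> 1" by (rule m)
  have na: "(norm a)\<^sup>2 = 1" "(norm b)\<^sup>2 = 1" using S by (simp_all add: m(2))
  have nc: "(norm c)\<^sup>2 = u" "(norm d)\<^sup>2 = u" using S' by (simp_all add: m(3))
  have Lspan: "L = int_module.span {a, b}" and Mspan: "M = int_module.span {c, d}"
    using tempered_minima_bases[OF L M min S SL S' SM] .
  define \<gamma> where "\<gamma> = of_nat l * (c * d / of_real u) * cnj (a * b)"
  have \<gamma>L: "\<gamma> * v \<in> L" if "v \<in> L" for v
    unfolding \<gamma>_def using u that
    by (intro reflections_multiplier[OF \<open>M \<subseteq> L\<close> lL Lspan Mspan na nc]) auto
  have aa: "a * cnj a = 1" "b * cnj b = 1"
    by (simp_all add: complex_norm_square[symmetric] na flip: of_real_power)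
  have norm\<gamma>: "norm \<gamma> = l"
  proof -
    have n: "norm a = 1" "norm b = 1" "norm c = sqrt u" "norm d = sqrt u"
      using na nc u by (simp_all add: real_sqrt_unique power2_eq_iff_nonneg[of _ 1, simplified])
        (simp_all flip: nc)
    show ?thesis using u unfolding \<gamma>_def by (simp add: norm_mult norm_divide n)
  qed
  have Im\<gamma>: "Im \<gamma> \<noteq> 0"
  proof
    assume "Im \<gamma> = 0"
    then have \<gamma>r: "\<gamma> = of_real (Re \<gamma>)" by (simp add: complex_eq_iff)
    have l0: "real l \<noteq> 0" using l by simp
    \<comment> \<open>Found by solving \<open>\<gamma> * (a * b) = l * (c * d / u)\<close> for
      \<open>c * d\<close>, with \<open>\<gamma>\<close> real.\<close>
    define \<sigma> where "\<sigma> = u * Re \<gamma> / l"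
    have "\<gamma> * (a * b) = of_nat l * (c * d / of_real u) * ((a * cnj a) * (b * cnj b))"
      unfolding \<gamma>_def by simp
    then have "\<gamma> * (a * b) = of_nat l * (c * d / of_real u)" unfolding aa by simp
    then have "of_real (Re \<gamma>) * (a * b) = of_nat l * (c * d / of_real u)"
      using \<gamma>r by simp
    then have cd: "c * d = of_real \<sigma> * (a * b)"
      using l0 u unfolding \<sigma>_def by (simp add: field_simps)
    have "\<sigma> \<noteq> 0" using cd nc u by auto
    obtain B u' where B: "pos_def_quadratic_form B" "tempered_minima L M S S' B u'"
      "B \<noteq> (\<lambda>v. v \<bullet> v)"
      using common_axes_not_perfect[OF \<open>M \<subseteq> L\<close> Lspan S S'(1) cd \<open>\<sigma> \<noteq> 0\<close> min] .
    show False using perf[OF B(1,2)] B(3) by contradiction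
  qed
  show thesis by (rule that[OF norm\<gamma> Im\<gamma> \<gamma>L])
qed

section \<open>From the multiplier to the discriminant\<close>

theorem theorem2:
  fixes l :: nat and D :: int and K R L M :: "complex set"
  assumes "prime l"
    and "imaginary_quadratic_field K"
    and "order_in K R"
    and "has_discriminant R D"
    and "s_and_s'_form l 2 2 L M"
    and "arises_from_ideal_classes K R L M"
  shows "\<bar>D\<bar> \<le> 4 * (int l)\<^sup>2"
proof -
  obtain k S S' where k: "k > 0"
    and ntp: "normalized_tempered_perfect ((*\<^sub>R) k ` L) ((*\<^sub>R) k ` M) S S'"
    and pairs: "consists_of_pairs 2 S" "consists_of_pairs 2 S'"
    and sub: "sublattice_of_index l L M"
    using assms(5) unfolding s_and_s'_form_def by blast
  define L1 M1 where "L1 = (*\<^sub>R) k ` L" and "M1 = (*\<^sub>R) k ` M"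
  have LM: "int_module.subspace L" "int_module.subspace M" "M \<subseteq> L"
    using sub lattice_subspace by (auto simp: sublattice_of_index_def)
  have L1: "int_module.subspace L1" and M1: "int_module.subspace M1" and M1L1: "M1 \<subseteq> L1"
    using subspace_scaleR_image[OF LM(1)] subspace_scaleR_image[OF LM(2)] LM(3)
    by (auto simp: L1_def M1_def)
  have lL1: "of_nat l * v \<in> M1" if v: "v \<in> L1" for v
  proof -
    obtain y where y: "y \<in> L" "v = k *\<^sub>R y" using v L1_def by blast
    have "of_nat l * y \<in> M"
      using index_mult_mem[OF LM _ y(1)] sub by (auto simp: sublattice_of_index_def)
    then show ?thesis unfolding M1_def y by (intro image_eqI[of _ _ "of_nat l * y"]) auto
  qed
  have "l \<noteq> 0" using assms(1) not_prime_0 by metis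
  obtain \<gamma> where norm\<gamma>: "norm \<gamma> = real l" and Im\<gamma>: "Im \<gamma> \<noteq> 0"
    and \<gamma>L: "\<And>v. v \<in> L1 \<Longrightarrow> \<gamma> * v \<in> L1"
    using perfect_pair_multiplier[OF L1 M1 M1L1 \<open>l \<noteq> 0\<close> lL1 ntp[folded L1_def M1_def] pairs] by blast
  \<comment> \<open>An element of \<open>S\<close> supplies the non-zero lattice vector by which to
    divide in \<open>K\<close>.\<close>
  have "S \<noteq> {}" "S \<subseteq> L1 - M1"
    using ntp by (simp_all add: normalized_tempered_perfect_def L1_def M1_def)
  then obtain a where a: "a \<in> L1" "a \<notin> M1" by blast
  then have "a \<noteq> 0" using int_module.subspace_0[OF M1] by metis
  obtain w where w: "w \<noteq> 0" "proper_fractional_ideal K R ((*) w ` L)"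
    using assms(6) unfolding arises_from_ideal_classes_def by blast
  \<comment> \<open>Multiplication by \<open>\<gamma>\<close> commutes with the scalings by
    \<open>k\<close> and \<open>w\<close>, so the multiplier passes from \<open>L1\<close> to
    \<open>L\<close> and on to the ideal.\<close>
  have \<gamma>L0: "\<gamma> * v \<in> L" if "v \<in> L" for v
  proof -
    have "\<gamma> * (k *\<^sub>R v) \<in> L1" using that \<gamma>L L1_def by blast
    then obtain y where "y \<in> L" "\<gamma> * (k *\<^sub>R v) = k *\<^sub>R y" unfolding L1_def by blast
    then show ?thesis using k by simp
  qed
  obtain a0 where a0: "a0 \<in> L" "a = k *\<^sub>R a0" using a(1) L1_def by blast
  have \<gamma>R: "\<gamma> \<in> R"
  proof (rule coefficient_ringI[OF assms(2) w(2)])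
    show "w * a0 \<in> (*) w ` L" using a0 by blast
    show "w * a0 \<noteq> 0" using w(1) a0(2) \<open>a \<noteq> 0\<close> by simp
    show "\<gamma> * v \<in> (*) w ` L" if "v \<in> (*) w ` L" for v
      using that \<gamma>L0 by (auto simp: mult.left_commute[of \<gamma> w])
  qed
  have "1 \<in> R" using assms(3) by (simp add: order_in_def)
  then have "\<bar>real_of_int D\<bar> \<le> 4 * (Im \<gamma>)\<^sup>2" using discriminant_bound[OF assms(4) _ \<gamma>R Im\<gamma>] by blast
  also have "\<dots> \<le> 4 * (real l)\<^sup>2"
    using power_mono[OF abs_Im_le_cmod[of \<gamma>], of 2] norm\<gamma> by simp
  finally have "real_of_int \<bar>D\<bar> \<le> real_of_int (4 * (int l)\<^sup>2)" by simp
  then show ?thesis by (simp only: of_int_le_iff)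
qed

end
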